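(* Let $n\geq 4$ and $\lceil n/2\rceil<m\leq n-1$. Then there is no optimal graph in $\mathcal{G}_{n,m}$.
   Context: All graphs are finite and simple. A set $S$ of vertices of a graph $G$ is dominating if every vertex of $G$ is in $S$ or adjacent to a vertex of $S$. The domination polynomial is $D(G,x)=\sum_{i=1}^{|V(G)|} d(G,i)x^i$, where $d(G,i)$ is the number of dominating sets of $G$ of cardinality $i$. $\mathcal{G}_{n,m}$ denotes the set of simple graphs with $n$ vertices and $m$ edges. A graph $H\in\mathcal{G}_{n,m}$ is optimal if $D(H,x)\geq D(G,x)$ for all $G\in\mathcal{G}_{n,m}$ and all $x\geq 0$. *)

theory Defs
  imports
    Complex_Main
    "HOL-Computational_Algebra.Polynomial"
    "Graph_Theory.Pair_Digraph"
begin

text \<open>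
  Finite simple graphs are the library's \<^locale>\<open>pair_graph\<close>s: finite, loop-free digraphs
  without parallel arcs whose arc relation is symmetric.  Every undirected edge is thus
  represented by two arcs; \<open>edges\<close> recovers the edges as two-element vertex sets.
\<close>

definition edges :: "'a pair_pre_digraph \<Rightarrow> 'a set set" where
  "edges G = {{u, v} |u v. (u, v) \<in> parcs G}"

definition dominating_set :: "'a pair_pre_digraph \<Rightarrow> 'a set \<Rightarrow> bool" where
  "dominating_set G S \<longleftrightarrow>
     S \<subseteq> pverts G \<and> (\<forall>v\<in>pverts G. v \<in> S \<or> (\<exists>u\<in>S. {u, v} \<in> edges G))"

definition num_dominating_sets :: "'a pair_pre_digraph \<Rightarrow> nat \<Rightarrow> nat" where
  "num_dominating_sets G i = card {S. dominating_set G S \<and> card S = i}"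

definition domination_poly :: "'a pair_pre_digraph \<Rightarrow> real poly" where
  "domination_poly G =
     (\<Sum>i = 1..card (pverts G). monom (real (num_dominating_sets G i)) i)"

definition graphs_with :: "nat \<Rightarrow> nat \<Rightarrow> 'a pair_pre_digraph set" where
  "graphs_with n m = {G. pair_graph G \<and> card (pverts G) = n \<and> card (edges G) = m}"

text \<open>
  Competitors have the same vertex type \<open>'a\<close> as \<open>H\<close>.  This is no restriction: if \<open>H\<close> has
  \<open>n\<close> vertices, then every graph on \<open>n\<close> vertices has an isomorphic copy on \<open>pverts H\<close>.
\<close>

definition optimal_graph :: "nat \<Rightarrow> nat \<Rightarrow> 'a pair_pre_digraph \<Rightarrow> bool" where
  "optimal_graph n m H \<longleftrightarrow>
     H \<in> graphs_with n m \<and>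
     (\<forall>G :: 'a pair_pre_digraph. G \<in> graphs_with n m \<longrightarrow> (\<forall>x\<ge>0.
        poly (domination_poly H) x \<ge> poly (domination_poly G) x))"

end

theory Submission
  imports Defs
begin

text \<open>
  Suppose \<open>H\<close> is optimal.  As \<open>x\<close> tends to \<open>0\<close>, comparison with a star plus \<open>n - m - 1\<close> isolated
  vertices shows that \<open>H\<close> has a dominating set of size at most \<open>n - m\<close>.  Each vertex outside that
  set uses up an edge of its own, so these are all the edges and every edge of \<open>H\<close> is pendant.
  The complement of a pendant edge is not dominating, so \<open>d(H, n-2) \<le> C(n,2) - m\<close>.
  Since \<open>m > \<lceil>n/2\<rceil>\<close>, some graph in the class has no isolated vertices and a
  non-pendant edge; its coefficients of \<open>x^n\<close> and \<open>x^(n-1)\<close> are the largest possible and that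
  of \<open>x^(n-2)\<close> is at least \<open>C(n,2) - m + 1\<close>, so it beats \<open>H\<close> as \<open>x\<close> tends to infinity.
\<close>

lemma edges_pair_graph:
  assumes "pair_graph G" "e \<in> edges G"
  shows "e \<subseteq> pverts G" "card e = 2"
proof -
  interpret pair_graph G by fact
  obtain u v where e: "e = {u, v}" "(u, v) \<in> parcs G"
    using assms(2) by (auto simp: edges_def)
  show "e \<subseteq> pverts G" using e in_arcsD1 in_arcsD2 by auto
  show "card e = 2" using e pair_no_loops[OF e(2)] by auto
qed

lemma finite_pverts_pair_graph: "pair_graph G \<Longrightarrow> finite (pverts G)"
  by (simp add: pair_graph_def pair_digraph_def pair_fin_digraph_def pair_fin_digraph_axioms_def)

lemma finite_edges_pair_graph: "pair_graph G \<Longrightarrow> finite (edges G)"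
  by (rule finite_subset[of _ "Pow (pverts G)"])
     (auto dest: edges_pair_graph(1) finite_pverts_pair_graph)

lemma poly_domination_poly:
  "poly (domination_poly G) x = (\<Sum>i = 1..card (pverts G). real (num_dominating_sets G i) * x ^ i)"
  by (simp add: domination_poly_def poly_sum poly_monom)

lemma coeff_domination_poly:
  "coeff (domination_poly G) i =
     (if i \<in> {1..card (pverts G)} then real (num_dominating_sets G i) else 0)"
  by (simp add: domination_poly_def coeff_sum)

text \<open>The top coefficients are compared through their deficit from the binomial coefficients,
  since large non-dominating sets can be counted by edges.\<close>

definition nondominating_sets :: "'a pair_pre_digraph \<Rightarrow> nat \<Rightarrow> 'a set set" where
  "nondominating_sets G i = {S. S \<subseteq> pverts G \<and> card S = i \<and> \<not> dominating_set G S}"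

lemma num_dominating_sets_plus_nondominating:
  assumes "finite (pverts G)"
  shows "num_dominating_sets G i + card (nondominating_sets G i) = card (pverts G) choose i"
proof -
  let ?D = "{S. dominating_set G S \<and> card S = i}"
  have fin: "finite {S. S \<subseteq> pverts G \<and> card S = i}" using assms by simp
  have "?D \<union> nondominating_sets G i = {S. S \<subseteq> pverts G \<and> card S = i}"
    by (auto simp: nondominating_sets_def dominating_set_def)
  moreover have "card (?D \<union> nondominating_sets G i) = card ?D + card (nondominating_sets G i)"
    by (rule card_Un_disjoint)
       (auto intro!: finite_subset[OF _ fin] simp: nondominating_sets_def dominating_set_def)
  ultimately show ?thesis
    using n_subsets[OF assms] by (simp add: num_dominating_sets_def)
qed

lemma num_dominating_sets_pos:
  assumes "finite (pverts G)" "dominating_set G S"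
  shows "num_dominating_sets G (card S) > 0"
proof -
  have "finite {T. dominating_set G T \<and> card T = card S}"
    by (rule finite_subset[of _ "Pow (pverts G)"]) (auto simp: dominating_set_def assms(1))
  then show ?thesis using assms(2) by (auto simp: num_dominating_sets_def card_gt_0_iff)
qed

definition no_isolated :: "'a pair_pre_digraph \<Rightarrow> bool" where
  "no_isolated G \<longleftrightarrow> (\<forall>v\<in>pverts G. \<exists>u. {u, v} \<in> edges G)"

text \<open>A non-dominating set misses some \<open>v\<close> together with all its neighbours,
  hence at least two vertices; here there is room to miss only one.\<close>

lemma nondominating_sets_no_isolated_empty:
  assumes "pair_graph G" "no_isolated G" "i \<le> card (pverts G)" "card (pverts G) \<le> i + 1"
  shows "nondominating_sets G i = {}"
proof (rule ccontr)
  assume "\<not> ?thesis"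
  then obtain S v where S: "S \<subseteq> pverts G" "card S = i" "v \<in> pverts G" "v \<notin> S"
    "\<And>u. u \<in> S \<Longrightarrow> {u, v} \<notin> edges G"
    by (auto simp: nondominating_sets_def dominating_set_def)
  have fin: "finite (pverts G)" by (rule finite_pverts_pair_graph[OF assms(1)])
  obtain u where u: "{u, v} \<in> edges G" using assms(2) S(3) by (auto simp: no_isolated_def)
  have "u \<in> pverts G" "u \<noteq> v" "u \<notin> S"
    using edges_pair_graph[OF assms(1) u] S(5) u by (auto simp: card_2_iff)
  then have "card (insert u (insert v S)) \<le> card (pverts G)"
    using S by (intro card_mono fin) auto
  moreover have "card (insert u (insert v S)) = i + 2"
    using S \<open>u \<noteq> v\<close> \<open>u \<notin> S\<close> finite_subset[OF S(1) fin] by auto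
  ultimately show False using assms(4) by simp
qed

text \<open>The two vertices missing from a non-dominating set of size \<open>k\<close> are some
  \<open>v\<close> and its only neighbour, so they form a pendant edge. Both ends of
  \<open>{a, b}\<close> have a further neighbour, so this edge never arises as such a
  complement.\<close>

lemma card_nondominating_sets_less_edges:
  assumes G: "pair_graph G" "no_isolated G" "card (pverts G) = k + 2"
    and e: "{a, b} \<in> edges G" "{a, a'} \<in> edges G" "{b, b'} \<in> edges G" "a' \<noteq> b" "b' \<noteq> a"
  shows "card (nondominating_sets G k) < card (edges G)"
proof -
  note ep = edges_pair_graph[OF G(1)]
  have fin: "finite (pverts G)" "finite (edges G)"
    by (simp_all add: G finite_pverts_pair_graph finite_edges_pair_graph)
  have "pverts G - S \<in> edges G - {{a, b}}" if nd: "S \<in> nondominating_sets G k" for S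
  proof -
    obtain v where S: "S \<subseteq> pverts G" "card S = k" and v: "v \<in> pverts G" "v \<notin> S"
      and nb: "\<And>u. {u, v} \<in> edges G \<Longrightarrow> u \<notin> S"
      using nd by (auto simp: nondominating_sets_def dominating_set_def)
    obtain u where u: "{u, v} \<in> edges G" using G(2) v(1) by (auto simp: no_isolated_def)
    have uv: "u \<noteq> v" using ep(2)[OF u] by auto
    have "card (pverts G - S) = 2"
      using S G(3) fin by (simp add: card_Diff_subset finite_subset)
    then have eq: "{u, v} = pverts G - S"
      using uv nb[OF u] v ep(1)[OF u] by (intro card_subset_eq) (auto simp: fin)
    have "w \<in> {u, v}" if "{w, v} \<in> edges G" for w
      using nb[OF that] ep(1)[OF that] eq by auto
    \<comment> \<open>If \<open>{u, v}\<close> were \<open>{a, b}\<close>, then \<open>v\<close>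
      would be \<open>a\<close> or \<open>b\<close>, and \<open>a'\<close> or \<open>b'\<close>
      would be a neighbour of \<open>v\<close> outside \<open>{u, v}\<close>.\<close>
    moreover have "{a', a} \<in> edges G" "{b', b} \<in> edges G" using e by (simp_all add: insert_commute)
    moreover have "a' \<noteq> a" "b' \<noteq> b" using ep(2)[OF e(2)] ep(2)[OF e(3)] by auto
    ultimately have "{u, v} \<noteq> {a, b}" using e(4,5) by (metis doubleton_eq_iff insertE singletonD)
    then show ?thesis using u eq by auto
  qed
  moreover have "inj_on (\<lambda>S. pverts G - S) (nondominating_sets G k)"
    by (rule inj_onI) (auto simp: nondominating_sets_def)
  ultimately have "card (nondominating_sets G k) \<le> card (edges G - {{a, b}})"
    by (intro card_inj_on_le) (auto simp: fin)
  also have "\<dots> < card (edges G)" using e(1) fin(2) by (rule card_Diff1_less[rotated])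
  finally show ?thesis .
qed

text \<open>Choosing for each vertex outside \<open>S\<close> an edge into \<open>S\<close> already
  exhausts all edges. So every edge has an end outside \<open>S\<close> that lies on no other edge,
  and removing both ends leaves that end undominated.\<close>

lemma card_edges_le_nondominating_sets:
  assumes G: "pair_graph G" "card (pverts G) = k + 2"
    and S: "dominating_set G S" "card S + card (edges G) \<le> card (pverts G)"
  shows "card (edges G) \<le> card (nondominating_sets G k)"
proof -
  note ep = edges_pair_graph[OF G(1)]
  let ?V = "pverts G"
  have fin: "finite ?V" "finite (edges G)"
    by (simp_all add: G finite_pverts_pair_graph finite_edges_pair_graph)
  have SV: "S \<subseteq> ?V" using S(1) by (simp add: dominating_set_def)
  obtain g where g: "\<And>v. v \<in> ?V - S \<Longrightarrow> g v \<in> S \<and> {g v, v} \<in> edges G"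
    using S(1) unfolding dominating_set_def by (metis DiffE)
  \<comment> \<open>The chosen edge determines \<open>v\<close> as its only end outside
    \<open>S\<close>.\<close>
  have inj: "inj_on (\<lambda>v. {g v, v}) (?V - S)"
    by (rule inj_onI) (metis DiffD2 doubleton_eq_iff g)
  have "card (edges G) \<le> card (?V - S)"
    using S(2) SV fin(1) by (simp add: card_Diff_subset finite_subset)
  also have "\<dots> = card ((\<lambda>v. {g v, v}) ` (?V - S))" by (simp add: card_image inj)
  finally have all: "(\<lambda>v. {g v, v}) ` (?V - S) = edges G"
    using g by (intro card_seteq fin) auto
  have "?V - e \<in> nondominating_sets G k" if e: "e \<in> edges G" for e
  proof -
    obtain v where v: "v \<in> ?V - S" "e = {g v, v}" using e all by auto
    have "{u, v} = e" if "{u, v} \<in> edges G" for u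
    proof -
      obtain v' where v': "v' \<in> ?V - S" "{u, v} = {g v', v'}" using \<open>{u, v} \<in> edges G\<close> all by auto
      then have "v = v'" using g[OF v'(1)] v(1) by (auto simp: doubleton_eq_iff)
      then show ?thesis using v v' by simp
    qed
    then have "\<not> dominating_set G (?V - e)"
      using v unfolding dominating_set_def by blast
    moreover have "card (?V - e) = k"
      using ep[OF e] fin(1) G(2) by (simp add: card_Diff_subset finite_subset)
    ultimately show ?thesis by (auto simp: nondominating_sets_def)
  qed
  moreover have "inj_on (\<lambda>e. ?V - e) (edges G)"
    by (rule inj_onI) (use ep(1) in blast)
  moreover have "finite (nondominating_sets G k)"
    by (rule finite_subset[of _ "Pow ?V"]) (auto simp: nondominating_sets_def fin)
  ultimately show ?thesis by (intro card_inj_on_le) auto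
qed

text \<open>The forest on \<open>f ` {..<n}\<close> with roots \<open>f ` {..<c}\<close> in which \<open>f i\<close> has parent \<open>f (p i)\<close>.\<close>

definition forest :: "(nat \<Rightarrow> 'a) \<Rightarrow> nat \<Rightarrow> nat \<Rightarrow> (nat \<Rightarrow> nat) \<Rightarrow> 'a pair_pre_digraph" where
  "forest f n c p = \<lparr>pverts = f ` {..<n},
     parcs = (\<Union>i\<in>{c..<n}. {(f i, f (p i)), (f (p i), f i)})\<rparr>"

lemma edges_forest: "edges (forest f n c p) = (\<lambda>i. {f i, f (p i)}) ` {c..<n}"
  by (auto simp: edges_def forest_def)

text \<open>Parents have smaller indices, so there are no loops and an edge determines its child as
  the end of larger index: each non-root contributes exactly one edge.\<close>

lemma forest_graphs_with:
  assumes f: "inj_on f {..<n}" and p: "\<And>i. i \<in> {c..<n} \<Longrightarrow> p i < i"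
  shows "forest f n c p \<in> graphs_with n (n - c)"
proof -
  have eq: "f x = f y \<longleftrightarrow> x = y" if "x < n" "y < n" for x y
    using f that by (auto dest: inj_onD)
  have "pair_graph (forest f n c p)"
  proof
    fix e assume "e \<in> parcs (forest f n c p)"
    then obtain i where i: "i \<in> {c..<n}" "e = (f i, f (p i)) \<or> e = (f (p i), f i)"
      by (auto simp: forest_def)
    have "p i < i" "p i < n" "i < n" using p[OF i(1)] i by auto
    then show "fst e \<in> pverts (forest f n c p)" "snd e \<in> pverts (forest f n c p)" "fst e \<noteq> snd e"
      using i eq by (auto simp: forest_def)
  next
    show "symmetric (with_proj (forest f n c p))"
      by (auto simp: symmetric_def sym_def forest_def)
  qed (auto simp: forest_def)
  moreover have "card (pverts (forest f n c p)) = n" by (simp add: forest_def card_image f)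
  moreover have "inj_on (\<lambda>i. {f i, f (p i)}) {c..<n}"
  proof (rule inj_onI)
    fix i j assume ij: "i \<in> {c..<n}" "j \<in> {c..<n}" "{f i, f (p i)} = {f j, f (p j)}"
    then have "p i < i" "p j < j" "i < n" "j < n" using p by auto
    then show "i = j" using ij(3) eq[of i j] eq[of i "p j"] eq[of "p i" j]
      by (auto simp: doubleton_eq_iff)
  qed
  then have "card (edges (forest f n c p)) = n - c" by (simp add: edges_forest card_image)
  ultimately show ?thesis by (simp add: graphs_with_def)
qed

theorem theorem2p8:
  fixes n m :: nat
  assumes "n \<ge> 4"
    and "\<lceil>real n / 2\<rceil> < int m"
    and "m \<le> n - 1"
  shows "\<not> (\<exists>H :: 'a pair_pre_digraph. optimal_graph n m H)"
proof
  assume "\<exists>H :: 'a pair_pre_digraph. optimal_graph n m H"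
  then obtain H :: "'a pair_pre_digraph" where H: "H \<in> graphs_with n m"
    and opt: "\<And>(G :: 'a pair_pre_digraph) x. G \<in> graphs_with n m \<Longrightarrow> x \<ge> 0 \<Longrightarrow>
      poly (domination_poly G) x \<le> poly (domination_poly H) x"
    by (auto simp: optimal_graph_def)
  have H': "pair_graph H" "card (pverts H) = n" "card (edges H) = m"
    using H by (auto simp: graphs_with_def)
  have finH: "finite (pverts H)" by (rule finite_pverts_pair_graph[OF H'(1)])
  define c where "c = n - m"
  \<comment> \<open>The strict bound on \<open>m\<close> gives \<open>2 * c + 2 \<le> n\<close>,
    exactly the room needed later for the vertices with indices \<open>2 * c\<close> and
    \<open>2 * c + 1\<close>.\<close>
  have "real n / 2 \<le> real m - 1" using assms(2) by linarith
  then have c: "c \<ge> 1" "2 * c + 2 \<le> n" "n - c = m" "c + m = n"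
    using assms(1,3) by (auto simp: c_def)
  obtain f :: "nat \<Rightarrow> 'a" where "bij_betw f {0..<n} (pverts H)"
    using ex_bij_betw_nat_finite[OF finH] H'(2) by auto
  then have f: "inj_on f {..<n}" by (simp add: bij_betw_def atLeast0LessThan)

  \<comment> \<open>A star centred at \<open>f 0\<close>; the other \<open>c - 1\<close> roots stay
    isolated, so the \<open>c\<close> roots dominate.\<close>
  define A where "A = forest f n c (\<lambda>i. 0)"
  have A: "A \<in> graphs_with n m" using forest_graphs_with[OF f, of c "\<lambda>i. 0"] c by (simp add: A_def)
  then have A': "pair_graph A" "card (pverts A) = n" by (auto simp: graphs_with_def)
  have "dominating_set A (f ` {..<c})"
    unfolding dominating_set_def
  proof (intro conjI ballI)
    show "f ` {..<c} \<subseteq> pverts A" using c by (auto simp: A_def forest_def)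
    fix v assume "v \<in> pverts A"
    then obtain i where i: "v = f i" "i < n" by (auto simp: A_def forest_def)
    show "v \<in> f ` {..<c} \<or> (\<exists>u\<in>f ` {..<c}. {u, v} \<in> edges A)"
    proof (cases "i < c")
      case False
      then have "{f 0, v} \<in> edges A" using i by (auto simp: A_def edges_forest)
      then show ?thesis using c(1) by auto
    qed (use i in auto)
  qed
  moreover have "card (f ` {..<c}) = c"
    using c by (simp add: card_image inj_on_subset[OF f])
  ultimately have dA: "num_dominating_sets A c \<ge> 1"
    using num_dominating_sets_pos[of A] A' finite_pverts_pair_graph by fastforce

  have "\<exists>i\<in>{1..c}. num_dominating_sets H i > 0"
  proof (rule ccontr)
    assume "\<not> ?thesis"
    then have z: "num_dominating_sets H i = 0" if "i \<in> {1..c}" for i using that by auto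
    define M where "M = (\<Sum>i = 1..n. real (num_dominating_sets H i))"
    \<comment> \<open>Without terms of degree at most \<open>c\<close>, the polynomial of
      \<open>H\<close> is at most \<open>M * x ^ Suc c\<close> on \<open>[0, 1]\<close>, which is
      below \<open>x ^ c\<close> once \<open>M * x < 1\<close>. The summand 1 also ensures
      \<open>x \<le> 1\<close>.\<close>
    define x where "x = 1 / (M + 1)"
    have M: "M \<ge> 0" by (simp add: M_def sum_nonneg)
    then have x: "0 < x" "x \<le> 1" "M * x < 1" by (simp_all add: x_def field_simps)
    have "x ^ c \<le> real (num_dominating_sets A c) * x ^ c" using dA x(1) by simp
    also have "\<dots> \<le> poly (domination_poly A) x"
      unfolding poly_domination_poly A'(2)
      by (rule member_le_sum) (use c x in auto)
    also have "\<dots> \<le> poly (domination_poly H) x" using opt[OF A] x by simp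
    also have "\<dots> \<le> (\<Sum>i = 1..n. real (num_dominating_sets H i) * x ^ Suc c)"
      unfolding poly_domination_poly H'(2)
    proof (rule sum_mono)
      fix i assume i: "i \<in> {1..n}"
      show "real (num_dominating_sets H i) * x ^ i \<le> real (num_dominating_sets H i) * x ^ Suc c"
      proof (cases "i \<le> c")
        case False
        then show ?thesis using x by (intro mult_left_mono power_decreasing) auto
      qed (use z i in auto)
    qed
    also have "\<dots> = (M * x) * x ^ c" by (simp add: M_def sum_distrib_right mult.assoc)
    also have "\<dots> < x ^ c" using x by simp
    finally show False by simp
  qed
  then obtain S where S: "dominating_set H S" "card S \<le> c"
    by (auto simp: num_dominating_sets_def card_gt_0_iff)
  have topH: "num_dominating_sets H i \<le> n choose i" for i
    using num_dominating_sets_plus_nondominating[OF finH, of i] H' by simp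
  have "m \<le> card (nondominating_sets H (n - 2))"
    unfolding H'(3)[symmetric]
    by (rule card_edges_le_nondominating_sets[OF H'(1) _ S(1)]) (use S(2) H' c in linarith)+
  then have "num_dominating_sets H (n - 2) + m \<le> n choose (n - 2)"
    using H'(2) num_dominating_sets_plus_nondominating[OF finH, of "n - 2"] by simp

  text \<open>\<open>c - 1\<close> copies of \<open>K\<^sub>2\<close> and one tree, in which the edge between \<open>0\<close> and \<open>c\<close> is not
    pendant because \<open>0\<close> is adjacent to \<open>2 c\<close> and \<open>c\<close> to \<open>2 c + 1\<close>.\<close>
  define p where "p i = (if i < 2 * c then i - c else if i = 2 * c + 1 then c else 0)" for i
  define B where "B = forest f n c p"
  have B: "B \<in> graphs_with n m"
    using forest_graphs_with[OF f, of c p] c by (auto simp: B_def p_def)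
  then have B': "pair_graph B" "card (pverts B) = n" "card (edges B) = m"
    by (auto simp: graphs_with_def)
  have finB: "finite (pverts B)" by (rule finite_pverts_pair_graph[OF B'(1)])
  have eB: "{f i, f (p i)} \<in> edges B" if "c \<le> i" "i < n" for i
    using that by (auto simp: B_def edges_forest)
  have iso: "no_isolated B"
    unfolding no_isolated_def
  proof
    fix v assume "v \<in> pverts B"
    then obtain i where i: "v = f i" "i < n" by (auto simp: B_def forest_def)
    show "\<exists>u. {u, v} \<in> edges B"
    proof (cases "i < c")
      \<comment> \<open>The root with index \<open>i\<close> is matched to the vertex with index
        \<open>i + c\<close>, which exists because \<open>2 * c < n\<close>.\<close>
      case True
      then have "p (i + c) = i" by (simp add: p_def)
      then show ?thesis using eB[of "i + c"] True c i by auto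
    next
      case False
      then have "{f (p i), v} \<in> edges B" using eB[of i] i by (simp add: insert_commute)
      then show ?thesis by blast
    qed
  qed
  have "{f 0, f c} \<in> edges B" "{f 0, f (2 * c)} \<in> edges B" "{f c, f (2 * c + 1)} \<in> edges B"
    using eB[of c] eB[of "2 * c"] eB[of "2 * c + 1"] c by (auto simp: p_def insert_commute)
  moreover have "f (2 * c) \<noteq> f c" "f (2 * c + 1) \<noteq> f 0"
    using c by (auto dest!: inj_onD[OF f])
  ultimately have "card (nondominating_sets B (n - 2)) < m"
    using card_nondominating_sets_less_edges[of B "n - 2" "f 0" "f c" "f (2 * c)" "f (2 * c + 1)"]
      B' iso c by simp
  then have less: "num_dominating_sets H (n - 2) < num_dominating_sets B (n - 2)"
    using num_dominating_sets_plus_nondominating[OF finB, of "n - 2"] B'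
      \<open>num_dominating_sets H (n - 2) + m \<le> n choose (n - 2)\<close> by simp
  have topB: "num_dominating_sets B i = n choose i" if "i \<le> n" "n - 2 < i" for i
    using num_dominating_sets_plus_nondominating[OF finB, of i]
      nondominating_sets_no_isolated_empty[OF B'(1) iso, of i] B' that by simp

  define q where "q = domination_poly B - domination_poly H"
  have cq: "coeff q i = (if i \<in> {1..n} then
      real (num_dominating_sets B i) - real (num_dominating_sets H i) else 0)" for i
    by (simp add: q_def coeff_domination_poly H' B')
  have pos: "coeff q (n - 2) > 0" using less assms(1) by (simp add: cq)
  \<comment> \<open>Either \<open>q\<close> has degree \<open>n - 2\<close>, where its coefficient
    is positive, or its leading coefficient lies higher, where \<open>B\<close> attains the binomial
    bound.\<close>
  have "coeff q i \<ge> 0" if "i > n - 2" for i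
    using topB[of i] topH[of i] that by (auto simp: cq)
  moreover have "degree q \<ge> n - 2" using pos by (intro le_degree) simp
  ultimately have "lead_coeff q \<ge> 0" using pos by (cases "degree q = n - 2") auto
  then have lc: "lead_coeff q > 0" using pos by (cases "q = 0") (auto simp: less_le)
  then obtain N where N: "\<And>x. x \<ge> N \<Longrightarrow> lead_coeff q \<le> poly q x"
    using poly_pinfty_gt_lc by blast
  \<comment> \<open>Optimality speaks only of nonnegative arguments, hence the maximum with
    0.\<close>
  have "poly q (max N 0) > 0" using N[of "max N 0"] lc by linarith
  then show False using opt[OF B, of "max N 0"] by (simp add: q_def)
qed

end
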